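(* Let $p$ be a prime and $q\in\mathbb{C}_p$ with $|1-q|_p<1$. (I) For $s\in\mathbb{N}$ and $n_1,\ldots,n_s,k\in\mathbb{N}$ with $n_1+\cdots+n_s>sk+1$, $$\int_{\mathbb{Z}_p}\Big(\prod_{i=1}^s B_{k,n_i}(x,q)\Big)d\mu_q(x)=\Big(\prod_{i=1}^s\binom{n_i}{k}\Big)\sum_{l=0}^{sk}\binom{sk}{l}(-1)^{sk+l}\Big\{\sum_{i=1}^s n_i-l+1-q+q^2\beta_{n_1+\cdots+n_s-l,\frac{1}{q}}\Big\}.$$ (II) For $s\in\mathbb{N}$ and $n_1,\ldots,n_s,k\in\mathbb{Z}_+$, $$\int_{\mathbb{Z}_p}\Big(\prod_{i=1}^s B_{k,n_i}(x,q)\Big)d\mu_q(x)=\Big(\prod_{i=1}^s\binom{n_i}{k}\Big)\sum_{l=0}^{n_1+\cdots+n_s-sk}\binom{n_1+\cdots+n_s-sk}{l}(-1)^l\beta_{sk+l,q}.$$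
   Context: $\mathbb{Z}_+=\mathbb{N}\cup\{0\}$. For $y\in\mathbb{Z}_p$, $[y]_q=\frac{1-q^y}{1-q}$ and $[y]_{1/q}$ is the same with $q$ replaced by $q^{-1}$. Kim's $q$-Bernstein polynomials are $B_{k,n}(x,q)=\binom{n}{k}[x]_q^k[1-x]_{1/q}^{n-k}$ for $k,n\in\mathbb{Z}_+$. For a uniformly differentiable $f:\mathbb{Z}_p\to\mathbb{C}_p$, $\int_{\mathbb{Z}_p}f(x)\,d\mu_q(x)=\lim_{N\to\infty}\frac{1}{[p^N]_q}\sum_{x=0}^{p^N-1}f(x)q^x$. The Carlitz $q$-Bernoulli numbers are defined by $\beta_{0,q}=1$ and $q(q\beta+1)^k-\beta_{k,q}=1$ if $k=1$, $0$ if $k>1$, with the umbral convention of replacing $\beta^i$ by $\beta_{i,q}$ after binomial expansion; $\beta_{k,1/q}$ denotes the same numbers with $q$ replaced by $q^{-1}$.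
   Formalization: It is additionally assumed that q is not a root of unity other than 1; for such q with |1-q|_p<1 one has [p^N]_q=0 for large N, so the integral (and the Carlitz numbers) are undefined. For q=1, [y]_q is read as its limit y. *)

theory Defs
  imports "HOL-Analysis.Analysis" "HOL-Computational_Algebra.Computational_Algebra"
begin

text \<open>
  Fields that are complete with respect to a non-Archimedean absolute value. The constant
  \<^const>\<open>norm\<close> is constrained to real vector spaces, so the absolute value is given as the
  distance to \<open>0\<close> for a translation invariant metric.
\<close>

class complete_nonarch_field = field_char_0 + complete_space +
  assumes dist_diff_0: "dist x y = dist (x - y) 0"
    and dist_mult_0: "dist (x * y) 0 = dist x 0 * dist y 0"
    and dist_add_0: "dist (x + y) 0 \<le> max (dist x 0) (dist y 0)"

definition vabs :: "'a::complete_nonarch_field \<Rightarrow> real" where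
  "vabs x = dist x 0"

text \<open>
  The field \<open>C\<^sub>p\<close> is the completion of an algebraic closure of \<open>Q\<^sub>p\<close>. Since a type cannot depend on
  the number \<open>p\<close>, we say when a complete non-Archimedean field is (a copy of) \<open>C\<^sub>p\<close>.
  The absolute value is normalised by \<open>|p| = 1/p\<close>, so it is the \<open>p\<close>-adic absolute value on the rationals,
  and their closure in a complete field is their completion \<open>Q\<^sub>p\<close>.
\<close>

definition Qp :: "'a::complete_nonarch_field set" where
  "Qp = closure \<rat>"

definition Qp_bar :: "'a::complete_nonarch_field set" where
  "Qp_bar = {x. \<exists>P. P \<noteq> 0 \<and> (\<forall>i. coeff P i \<in> Qp) \<and> poly P x = 0}"

definition is_Cp :: "nat \<Rightarrow> 'a::complete_nonarch_field itself \<Rightarrow> bool" where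
  "is_Cp p T \<longleftrightarrow>
     vabs (of_nat p :: 'a) = 1 / real p \<and>
     (\<forall>P :: 'a poly. degree P > 0 \<and> (\<forall>i. coeff P i \<in> Qp_bar) \<longrightarrow> (\<exists>x\<in>Qp_bar. poly P x = 0)) \<and>
     closure (Qp_bar :: 'a set) = UNIV"

text \<open>
  For \<open>|1 - q| < 1\<close> the map \<open>n \<mapsto> q ^ n\<close> is \<open>p\<close>-adically uniformly continuous on the naturals,
  which are dense in the \<open>p\<close>-adic integers; \<open>q\<^sup>y\<close> is its continuous extension. It is meaningful for
  \<open>y\<close> in \<open>Z\<^sub>p\<close>, the closed unit ball of \<^const>\<open>Qp\<close>.
\<close>

definition padic_power :: "'a::complete_nonarch_field \<Rightarrow> 'a \<Rightarrow> 'a" where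
  "padic_power q y = Lim (filtercomap of_nat (nhds y)) (\<lambda>n::nat. q ^ n)"

text \<open>For \<open>q = 1\<close> the quotient is read as its limit for \<open>q \<rightarrow> 1\<close>.\<close>

definition qnum :: "'a::complete_nonarch_field \<Rightarrow> 'a \<Rightarrow> 'a" where
  "qnum q y = (if q = 1 then y else (1 - padic_power q y) / (1 - q))"

text \<open>For \<open>n < k\<close> the binomial coefficient vanishes, so truncation of the exponent \<open>n - k\<close> is harmless.\<close>

definition q_bernstein :: "nat \<Rightarrow> nat \<Rightarrow> 'a::complete_nonarch_field \<Rightarrow> 'a \<Rightarrow> 'a" where
  "q_bernstein k n x q = of_nat (n choose k) * qnum q x ^ k * qnum (1 / q) (1 - x) ^ (n - k)"

definition q_riemann_sum :: "nat \<Rightarrow> 'a::complete_nonarch_field \<Rightarrow> ('a \<Rightarrow> 'a) \<Rightarrow> nat \<Rightarrow> 'a" where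
  "q_riemann_sum p q f N =
     1 / qnum q (of_nat (p ^ N)) * (\<Sum>x = 0..p ^ N - 1. f (of_nat x) * q ^ x)"

definition q_integrable :: "nat \<Rightarrow> 'a::complete_nonarch_field \<Rightarrow> ('a \<Rightarrow> 'a) \<Rightarrow> bool" where
  "q_integrable p q f \<longleftrightarrow> convergent (q_riemann_sum p q f)"

definition q_integral :: "nat \<Rightarrow> 'a::complete_nonarch_field \<Rightarrow> ('a \<Rightarrow> 'a) \<Rightarrow> 'a" where
  "q_integral p q f = lim (q_riemann_sum p q f)"

text \<open>
  The umbral expression \<open>q (q \<beta> + 1)\<^sup>k\<close> is expanded by the binomial theorem, with
  \<open>\<beta>\<^sup>i\<close> replaced by \<open>\<beta> i\<close>.
\<close>

definition carlitz_sequence :: "'a::field_char_0 \<Rightarrow> (nat \<Rightarrow> 'a) \<Rightarrow> bool" where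
  "carlitz_sequence q \<beta> \<longleftrightarrow>
     \<beta> 0 = 1 \<and>
     (\<forall>k\<ge>1. q * (\<Sum>i\<le>k. of_nat (k choose i) * q ^ i * \<beta> i) - \<beta> k = (if k = 1 then 1 else 0))"

definition carlitz_bernoulli :: "nat \<Rightarrow> 'a::field_char_0 \<Rightarrow> 'a" where
  "carlitz_bernoulli k q = (THE \<beta>. carlitz_sequence q \<beta>) k"

text \<open>
  The recurrence determines \<open>\<beta> k\<close> through the factor \<open>q\<^sup>k\<^sup>+\<^sup>1 - 1\<close>, or, for \<open>q = 1\<close>, determines
  \<open>\<beta> k\<close> through the equation of index \<open>k + 1\<close>; so the numbers exist unless \<open>q \<noteq> 1\<close> is a root of unity.
\<close>

fun linrec :: "(nat \<Rightarrow> 'a) \<Rightarrow> (nat \<Rightarrow> nat \<Rightarrow> 'a) \<Rightarrow> nat \<Rightarrow> 'a::field" where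
  "linrec c a m = c m - (\<Sum>i<m. a m i * linrec c a i)"

declare linrec.simps [simp del]

lemma linrec_ex1:
  fixes c :: "nat \<Rightarrow> 'a::field"
  shows "\<exists>!\<beta>. \<forall>m. \<beta> m = c m - (\<Sum>i<m. a m i * \<beta> i)"
proof (rule ex1I[of _ "linrec c a"])
  show "\<forall>m. linrec c a m = c m - (\<Sum>i<m. a m i * linrec c a i)"
    by (metis linrec.simps)
next
  fix \<beta> assume \<beta>: "\<forall>m. \<beta> m = c m - (\<Sum>i<m. a m i * \<beta> i)"
  have "\<beta> m = linrec c a m" for m
  proof (induction m rule: less_induct)
    case (less m)
    then have "(\<Sum>i<m. a m i * \<beta> i) = (\<Sum>i<m. a m i * linrec c a i)"
      by (intro sum.cong) auto
    then show ?case
      using \<beta> linrec.simps[of c a m] by metis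
  qed
  then show "\<beta> = linrec c a" by blast
qed

lemma eq_div_diff_iff: "d \<noteq> 0 \<Longrightarrow> b = e / d - S / d \<longleftrightarrow> S + d * b = (e :: 'a::field)"
  by (auto simp: field_simps)

lemma carlitz_sequence_ex1:
  fixes q :: "'a::field_char_0"
  assumes "\<And>m. m > 0 \<Longrightarrow> q ^ m = 1 \<Longrightarrow> q = 1"
  shows "\<exists>!\<beta>. carlitz_sequence q \<beta>"
proof (cases "q = 1")
  case True
  define c where "c = (\<lambda>m::nat. if m = 0 then 1 else 0 :: 'a)"
  define a where "a = (\<lambda>m i::nat. of_nat (Suc m choose i) / of_nat (Suc m) :: 'a)"
  have eq: "\<beta> m = c m - (\<Sum>i<m. a m i * \<beta> i) \<longleftrightarrow>
      q * (\<Sum>i\<le>Suc m. of_nat (Suc m choose i) * q ^ i * \<beta> i) - \<beta> (Suc m)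
        = (if Suc m = 1 then 1 else 0)" for \<beta> m
  proof -
    have nz: "(of_nat (Suc m) :: 'a) \<noteq> 0"
      by (simp only: of_nat_eq_0_iff)
    have "(\<Sum>i<m. a m i * \<beta> i) = (\<Sum>i<m. of_nat (Suc m choose i) * \<beta> i) / of_nat (Suc m)"
      by (simp add: a_def sum_divide_distrib)
    moreover have "q * (\<Sum>i\<le>Suc m. of_nat (Suc m choose i) * q ^ i * \<beta> i) - \<beta> (Suc m)
        = (\<Sum>i<m. of_nat (Suc m choose i) * \<beta> i) + of_nat (Suc m) * \<beta> m"
      by (simp add: True flip: lessThan_Suc_atMost)
    moreover have "c m = (if Suc m = 1 then 1 else 0) / of_nat (Suc m)"
      by (simp add: c_def)
    ultimately show ?thesis
      using eq_div_diff_iff[OF nz] by presburger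
  qed
  have "carlitz_sequence q \<beta> \<longleftrightarrow> (\<forall>m. \<beta> m = c m - (\<Sum>i<m. a m i * \<beta> i))" for \<beta>
  proof -
    have *: "(\<forall>k\<ge>1. P k) \<longleftrightarrow> (\<forall>m. P (Suc m))" for P :: "nat \<Rightarrow> bool"
      by (metis One_nat_def Suc_le_D Suc_le_mono le0)
    have "\<beta> 0 = 1" if "\<forall>m. \<beta> m = c m - (\<Sum>i<m. a m i * \<beta> i)"
      using that[rule_format, of 0] by (simp add: c_def)
    then show ?thesis
      unfolding carlitz_sequence_def * eq[symmetric] by blast
  qed
  then show ?thesis
    using linrec_ex1[of c a] by simp
next
  case False
  define c where "c = (\<lambda>k::nat. if k = 0 then 1 else if k = 1 then 1 / (q ^ Suc k - 1) else 0 :: 'a)"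
  define a where "a = (\<lambda>k i::nat. q * of_nat (k choose i) * q ^ i / (q ^ Suc k - 1) :: 'a)"
  have eq: "\<beta> k = c k - (\<Sum>i<k. a k i * \<beta> i) \<longleftrightarrow>
      q * (\<Sum>i\<le>k. of_nat (k choose i) * q ^ i * \<beta> i) - \<beta> k = (if k = 1 then 1 else 0)"
    if "k \<ge> 1" for \<beta> k
  proof -
    define d where "d = q ^ Suc k - 1"
    have nz: "d \<noteq> 0"
      using assms[of "Suc k"] False unfolding d_def by auto
    define S where "S = q * (\<Sum>i<k. of_nat (k choose i) * q ^ i * \<beta> i)"
    have "(\<Sum>i<k. a k i * \<beta> i) = S / d"
      by (simp add: a_def S_def d_def sum_divide_distrib sum_distrib_left mult.assoc)
    moreover have "q * (\<Sum>i\<le>k. of_nat (k choose i) * q ^ i * \<beta> i) - \<beta> k = S + d * \<beta> k"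
      by (simp add: S_def d_def algebra_simps flip: lessThan_Suc_atMost)
    moreover have "c k = (if k = 1 then 1 else 0) / d"
      using that by (simp add: c_def d_def)
    ultimately show ?thesis
      using eq_div_diff_iff[OF nz] by presburger
  qed
  have "carlitz_sequence q \<beta> \<longleftrightarrow> (\<forall>k. \<beta> k = c k - (\<Sum>i<k. a k i * \<beta> i))" for \<beta>
  proof -
    have *: "(\<forall>k. P k) \<longleftrightarrow> P 0 \<and> (\<forall>k\<ge>1. P k)" for P :: "nat \<Rightarrow> bool"
      by (metis One_nat_def Suc_leI neq0_conv)
    have "\<beta> 0 = c 0 - (\<Sum>i<0. a 0 i * \<beta> i) \<longleftrightarrow> \<beta> 0 = 1"
      by (simp add: c_def)
    then show ?thesis
      unfolding carlitz_sequence_def *[of "\<lambda>k. \<beta> k = c k - (\<Sum>i<k. a k i * \<beta> i)"]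
      using eq by auto
  qed
  then show ?thesis
    using linrec_ex1[of c a] by simp
qed

end

theory Submission imports Defs begin

text \<open>
  On natural numbers \<open>x\<close> the identity \<open>[1 - x]\<^bsub>1/q\<^esub> = 1 - [x]\<^sub>q\<close> turns the product of Bernstein
  polynomials into a polynomial in \<open>[x]\<^sub>q\<close>. Since \<open>[x + 1]\<^sub>q = q [x]\<^sub>q + 1\<close>, the sums
  \<open>\<Sum>x<p\<^sup>N. [x]\<^sub>q\<^sup>k q\<^sup>x\<close> telescope; after division by \<open>[p\<^sup>N]\<^sub>q\<close> they satisfy the Carlitz recurrence up to an
  error that vanishes in the limit, because \<open>q\<close> to the power \<open>p\<^sup>N\<close> tends to \<open>1\<close>. So the integral is
  the umbral functional \<open>[x]\<^sub>q\<^sup>k \<mapsto> \<beta>\<^sub>k\<close>, which gives (II). For (I), uniqueness of the Carlitz numbers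
  identifies the functional with another one, given by \<open>\<beta>\<^sub>n\<close> for \<open>1/q\<close>, after the
  substitution \<open>y \<mapsto> 1 - y\<close>.
\<close>

section \<open>Linear functionals on polynomials given by their moments\<close>

lemma pcompose_power: "pcompose (P ^ n) Q = pcompose P Q ^ n"
  for P Q :: "'a::comm_ring_1 poly"
  by (induction n) (simp_all add: pcompose_mult pcompose_1)

text \<open>Monomials span the polynomials. This turns each umbral identity below into a check on
  powers of the variable.\<close>

lemma poly_linear_functional_eqI:
  fixes F G :: "'a::comm_ring_1 poly \<Rightarrow> 'a"
  assumes F: "\<And>P Q. F (P + Q) = F P + F Q" "\<And>c P. F (smult c P) = c * F P"
    and G: "\<And>P Q. G (P + Q) = G P + G Q" "\<And>c P. G (smult c P) = c * G P"
    and mon: "\<And>n. F ([:0, 1:] ^ n) = G ([:0, 1:] ^ n)"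
  shows "F P = G P"
proof -
  have zero: "F 0 = 0" "G 0 = 0"
    using F(2)[of 0 0] G(2)[of 0 0] by simp_all
  have "F (\<Sum>i\<in>A. smult (c i) ([:0, 1:] ^ i)) = G (\<Sum>i\<in>A. smult (c i) ([:0, 1:] ^ i))"
    if "finite A" for A :: "nat set" and c
    using that by induction (simp_all add: F G zero mon)
  from this[of "{..degree P}" "coeff P"] show ?thesis
    by (simp add: poly_as_sum_of_monoms flip: monom_altdef)
qed

text \<open>The umbral convention made precise: the linear extension of
  \<open>X ^ n \<mapsto> \<beta> n\<close>.\<close>

definition umbral :: "(nat \<Rightarrow> 'a) \<Rightarrow> 'a::comm_ring_1 poly \<Rightarrow> 'a" where
  "umbral \<beta> P = (\<Sum>i\<le>degree P. coeff P i * \<beta> i)"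

lemma umbral_eq_sum:
  assumes "degree P \<le> n"
  shows "umbral \<beta> P = (\<Sum>i\<le>n. coeff P i * \<beta> i)"
  unfolding umbral_def
  by (rule sum.mono_neutral_left) (use assms in \<open>auto simp: coeff_eq_0\<close>)

lemma umbral_add: "umbral \<beta> (P + Q) = umbral \<beta> P + umbral \<beta> Q"
proof -
  define n where "n = max (degree P) (degree Q)"
  have "degree (P + Q) \<le> n" "degree P \<le> n" "degree Q \<le> n"
    unfolding n_def by (simp_all add: degree_add_le_max)
  then show ?thesis
    by (simp add: umbral_eq_sum[of _ n] algebra_simps sum.distrib)
qed

lemma umbral_smult: "umbral \<beta> (smult c P) = c * umbral \<beta> P"
  unfolding umbral_eq_sum[OF degree_smult_le[of c P]] umbral_eq_sum[OF order.refl[of "degree P"]]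
  by (simp add: sum_distrib_left mult.assoc)

lemma umbral_sum: "umbral \<beta> (\<Sum>i\<in>A. f i) = (\<Sum>i\<in>A. umbral \<beta> (f i))"
proof -
  have "umbral \<beta> 0 = 0" by (simp add: umbral_def)
  then show ?thesis
    by (induction A rule: infinite_finite_induct) (simp_all add: umbral_add)
qed

lemma umbral_monom: "umbral \<beta> (monom c n) = c * \<beta> n"
proof -
  have "umbral \<beta> (monom c n) = (\<Sum>i\<le>n. if i = n then c * \<beta> i else 0)"
    unfolding umbral_eq_sum[OF degree_monom_le] by (intro sum.cong) auto
  then show ?thesis by (simp add: sum.delta)
qed

lemma umbral_X_power: "umbral \<beta> ([:0, 1:] ^ n) = \<beta> n"
  using umbral_monom[of \<beta> 1 n] by (simp add: monom_altdef)

lemma umbral_1: "umbral \<beta> 1 = \<beta> 0"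
  by (simp add: umbral_def)

lemma linear_poly_power:
  "[:a, b:] ^ m = (\<Sum>l\<le>m. monom (of_nat (m choose l) * b ^ l * a ^ (m - l)) l)"
  for a b :: "'a::comm_ring_1"
proof -
  have d: "degree ([:a, b:] ^ m) \<le> m"
    by (rule order.trans[OF degree_power_le]) simp
  have "[:a, b:] ^ m = (\<Sum>l\<le>m. monom (coeff ([:a, b:] ^ m) l) l)"
    by (rule poly_as_sum_of_monoms'[OF d, symmetric])
  then show ?thesis
    by (simp add: coeff_linear_poly_power)
qed

lemma umbral_linear_power_mult:
  "umbral \<beta> ([:a, b:] ^ m * [:0, 1:] ^ n) =
     (\<Sum>l\<le>m. of_nat (m choose l) * b ^ l * a ^ (m - l) * \<beta> (l + n))"
proof -
  have X: "[:0, 1:] ^ n = monom (1::'a) n"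
    by (simp add: monom_altdef)
  have "[:a, b:] ^ m * [:0, 1:] ^ n =
      (\<Sum>l\<le>m. monom (of_nat (m choose l) * b ^ l * a ^ (m - l)) (l + n))"
    unfolding linear_poly_power[of a b] X
    by (simp add: sum_distrib_right mult_monom)
  then show ?thesis
    by (simp add: umbral_sum umbral_monom)
qed

lemma umbral_linear_power:
  "umbral \<beta> ([:a, b:] ^ m) = (\<Sum>l\<le>m. of_nat (m choose l) * b ^ l * a ^ (m - l) * \<beta> l)"
  using umbral_linear_power_mult[of \<beta> a b m 0] by simp

section \<open>The Carlitz recurrence for polynomials and its reflection\<close>

lemma poly_pderiv_X_power_0: "poly (pderiv ([:0, 1:] ^ n)) 0 = (if n = 1 then 1 else 0)"
  for n :: nat
  by (cases n) (auto simp: pderiv_power_Suc pderiv_pCons power_0_left simp del: power_Suc)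

text \<open>On \<open>X ^ n\<close> with \<open>n \<ge> 1\<close> this is the defining recurrence,
  \<open>P'(0)\<close> being its right-hand side. The recurrence is not imposed at
  \<open>n = 0\<close>, where the left side is \<open>q - 1\<close>; the term in \<open>P(0)\<close>
  accounts for that.\<close>

lemma carlitz_sequence_umbral:
  fixes q :: "'a::field_char_0"
  assumes "carlitz_sequence q \<beta>"
  shows "q * umbral \<beta> (pcompose P [:1, q:]) - umbral \<beta> P
           = poly (pderiv P) 0 + (q - 1) * poly P 0"
proof (rule poly_linear_functional_eqI[of
      "\<lambda>P. q * umbral \<beta> (pcompose P [:1, q:]) - umbral \<beta> P"
      "\<lambda>P. poly (pderiv P) 0 + (q - 1) * poly P 0"])
  fix n :: nat
  have "q * (\<Sum>i\<le>n. of_nat (n choose i) * q ^ i * \<beta> i) - \<beta> n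
      = (if n = 1 then 1 else 0) + (q - 1) * 0 ^ n"
    using assms unfolding carlitz_sequence_def by (cases "n = 0") auto
  moreover have "umbral \<beta> (pcompose ([:0, 1:] ^ n) [:1, q:])
      = (\<Sum>i\<le>n. of_nat (n choose i) * q ^ i * \<beta> i)"
    by (simp add: pcompose_power pcompose_pCons umbral_linear_power)
  ultimately show "q * umbral \<beta> (pcompose ([:0, 1:] ^ n) [:1, q:]) - umbral \<beta> ([:0, 1:] ^ n)
      = poly (pderiv ([:0, 1:] ^ n)) 0 + (q - 1) * poly ([:0, 1:] ^ n) 0"
    by (simp only: umbral_X_power poly_pderiv_X_power_0 poly_power) simp
qed (simp_all add: pcompose_add pcompose_smult umbral_add umbral_smult pderiv_add pderiv_smult
    algebra_simps)

text \<open>The moments of \<open>1 - [x]\<^sub>q\<close>; the corrections at \<open>n = 0\<close> and \<open>n = 1\<close> make the linear functional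
  below obey the recurrence that \<open>x \<mapsto> x + 1\<close> induces.\<close>

definition reflected_carlitz :: "'a::field_char_0 \<Rightarrow> (nat \<Rightarrow> 'a) \<Rightarrow> nat \<Rightarrow> 'a" where
  "reflected_carlitz q \<beta>' n = of_nat n + (1 - q) + q ^ 2 * \<beta>' n
     + (if n = 0 then q * (1 - q) else if n = 1 then q ^ 2 else 0)"

text \<open>Every summand of \<open>reflected_carlitz\<close> is itself a moment sequence:
  \<open>n\<close> comes from \<open>P'(1)\<close>, the constant \<open>1\<close> from
  \<open>P(1)\<close>, and the indicators of \<open>n = 0\<close> and \<open>n = 1\<close> from
  \<open>P(0)\<close> and \<open>P'(0)\<close>.\<close>

lemma umbral_reflected_carlitz:
  "umbral (reflected_carlitz q \<beta>') P =
     poly (pderiv P) 1 + (1 - q) * poly P 1 + q ^ 2 * umbral \<beta>' P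
     + q * (1 - q) * poly P 0 + q ^ 2 * poly (pderiv P) 0"
proof (rule poly_linear_functional_eqI[of "umbral (reflected_carlitz q \<beta>')"
     "\<lambda>P. poly (pderiv P) 1 + (1 - q) * poly P 1 + q ^ 2 * umbral \<beta>' P
     + q * (1 - q) * poly P 0 + q ^ 2 * poly (pderiv P) 0"])
  fix n
  have "poly (pderiv ([:0, 1:] ^ n)) (1::'a) = of_nat n"
    by (cases n) (simp_all add: pderiv_power_Suc pderiv_pCons poly_power del: power_Suc)
  then show "umbral (reflected_carlitz q \<beta>') ([:0, 1:] ^ n) =
     poly (pderiv ([:0, 1:] ^ n)) 1 + (1 - q) * poly ([:0, 1:] ^ n) 1
     + q ^ 2 * umbral \<beta>' ([:0, 1:] ^ n)
     + q * (1 - q) * poly ([:0, 1:] ^ n) 0 + q ^ 2 * poly (pderiv ([:0, 1:] ^ n)) 0"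
    by (cases "n = 0")
      (simp_all add: umbral_1 power_0_left umbral_X_power poly_power poly_pderiv_X_power_0 reflected_carlitz_def)
qed (simp_all add: umbral_add umbral_smult pderiv_add pderiv_smult algebra_simps)

text \<open>In the variable \<open>z = 1 - y\<close> the shift \<open>y \<mapsto> q y + 1\<close>
  reads \<open>z \<mapsto> q z - q\<close>. Its inverse \<open>z \<mapsto> 1 + z / q\<close> is the
  shift for the base \<open>1 / q\<close>, so the recurrence of \<open>\<beta>'\<close> applies to
  the substituted polynomial. The values of \<open>P\<close> and \<open>P'\<close> at
  \<open>- q\<close> and at \<open>0\<close> then cancel.\<close>

lemma umbral_reflected_carlitz_shift:
  assumes q: "q \<noteq> 0" and "carlitz_sequence (1 / q) \<beta>'"
  shows "q * umbral (reflected_carlitz q \<beta>') (pcompose P [:- q, q:])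
           - umbral (reflected_carlitz q \<beta>') P
         = - (1 - q) * poly P 1 - poly (pderiv P) 1"
proof -
  define Q where "Q = pcompose P [:- q, q:]"
  have P: "pcompose Q [:1, 1 / q:] = P"
    using q by (simp add: Q_def pcompose_pCons flip: pcompose_assoc)
  have Q: "poly Q 0 = poly P (- q)" "poly Q 1 = poly P 0"
      "poly (pderiv Q) 0 = q * poly (pderiv P) (- q)"
      "poly (pderiv Q) 1 = q * poly (pderiv P) 0"
    by (simp_all add: Q_def poly_pcompose pderiv_pcompose pderiv_pCons)
  have "(1 / q) * umbral \<beta>' P - umbral \<beta>' Q = poly (pderiv Q) 0 + (1 / q - 1) * poly Q 0"
    using carlitz_sequence_umbral[OF assms(2), of Q] by (simp add: P)
  then have "q * umbral \<beta>' Q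
      = umbral \<beta>' P - q ^ 2 * poly (pderiv P) (- q) - (1 - q) * poly P (- q)"
    using q by (simp add: Q field_simps power2_eq_square)
  then have *: "q ^ 3 * umbral \<beta>' Q
      = q ^ 2 * (umbral \<beta>' P - q ^ 2 * poly (pderiv P) (- q) - (1 - q) * poly P (- q))"
    by (simp add: power3_eq_cube power2_eq_square)
  show ?thesis
    unfolding umbral_reflected_carlitz Q_def[symmetric] Q
    using * by (simp add: algebra_simps power3_eq_cube power2_eq_square)
qed

text \<open>The moments \<open>\<gamma>\<close> of \<open>1 - X\<close> under the reflected
  functional satisfy the Carlitz recurrence for \<open>q\<close>, so uniqueness forces
  \<open>\<gamma> = \<beta>\<close>.\<close>

lemma umbral_reflect:
  fixes q :: "'a::field_char_0"
  assumes q: "q \<noteq> 0" and uniq: "\<exists>!\<beta>. carlitz_sequence q \<beta>"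
    and \<beta>: "carlitz_sequence q \<beta>" and \<beta>': "carlitz_sequence (1 / q) \<beta>'"
  shows "umbral \<beta> P = umbral (reflected_carlitz q \<beta>') (pcompose P [:1, - 1:])"
proof -
  define H where "H = umbral (reflected_carlitz q \<beta>')"
  define \<gamma> where "\<gamma> j = H ([:1, - 1:] ^ j)" for j
  have H: "H (pcompose P [:1, - 1:]) = umbral \<gamma> P" for P
    by (rule poly_linear_functional_eqI)
      (simp_all add: H_def \<gamma>_def pcompose_add pcompose_smult umbral_add umbral_smult
        pcompose_power pcompose_pCons umbral_X_power)
  have "carlitz_sequence q \<gamma>"
    unfolding carlitz_sequence_def
  proof (intro conjI allI impI)
    have "\<beta>' 0 = 1"
      using \<beta>' by (simp add: carlitz_sequence_def)
    \<comment> \<open>The correction at \<open>n = 0\<close> makes this work: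
      \<open>(1 - q) + q^2 + q (1 - q) = 1\<close>.\<close>
    then show "\<gamma> 0 = 1"
      using umbral_X_power[of "reflected_carlitz q \<beta>'" 0]
      by (simp add: \<gamma>_def H_def reflected_carlitz_def algebra_simps power2_eq_square)
  next
    fix k :: nat
    assume k: "k \<ge> 1"
    have "(\<Sum>i\<le>k. of_nat (k choose i) * q ^ i * \<gamma> i) = umbral \<gamma> ([:1, q:] ^ k)"
      by (simp add: umbral_linear_power)
    \<comment> \<open>Both \<open>1 + q X\<close> at \<open>1 - X\<close> and \<open>1 - X\<close>
      at \<open>q X - q\<close> equal \<open>1 + q - q X\<close>.\<close>
    also have "\<dots> = H (pcompose ([:1, - 1:] ^ k) [:- q, q:])"
      by (simp add: pcompose_power pcompose_pCons flip: H)
    finally have "q * (\<Sum>i\<le>k. of_nat (k choose i) * q ^ i * \<gamma> i) - \<gamma> k =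
        - (1 - q) * poly ([:1, - 1:] ^ k) 1 - poly (pderiv ([:1, - 1:] ^ k)) 1"
      using umbral_reflected_carlitz_shift[OF q \<beta>', of "[:1, - 1:] ^ k"]
      by (simp add: H_def \<gamma>_def)
    \<comment> \<open>\<open>(1 - X) ^ k\<close> vanishes at \<open>1\<close>, and its derivative
      there is \<open>- 1\<close> for \<open>k = 1\<close> and \<open>0\<close> for larger
      \<open>k\<close>.\<close>
    also have "\<dots> = (if k = 1 then 1 else 0)"
      using k by (cases k) (auto simp: poly_power pderiv_power_Suc pderiv_pCons simp del: power_Suc)
    finally show "q * (\<Sum>i\<le>k. of_nat (k choose i) * q ^ i * \<gamma> i) - \<gamma> k = (if k = 1 then 1 else 0)" .
  qed
  then have "\<gamma> = \<beta>"
    using uniq \<beta> by blast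
  then show ?thesis
    using H by (simp add: H_def)
qed

section \<open>The non-Archimedean absolute value and its topology\<close>

lemma dist_eq_vabs: "dist x y = vabs (x - y)"
  unfolding vabs_def by (rule dist_diff_0)

lemma vabs_0 [simp]: "vabs 0 = 0" and vabs_eq_0_iff [simp]: "vabs x = 0 \<longleftrightarrow> x = 0"
  and vabs_nonneg [simp]: "vabs x \<ge> 0"
  by (simp_all add: vabs_def)

lemma vabs_mult: "vabs (x * y) = vabs x * vabs y"
  unfolding vabs_def by (rule dist_mult_0)

lemma vabs_add_le: "vabs (x + y) \<le> max (vabs x) (vabs y)"
  unfolding vabs_def by (rule dist_add_0)

lemma vabs_1 [simp]: "vabs (1 :: 'a::complete_nonarch_field) = 1"
proof -
  have "vabs (1::'a) * vabs (1::'a) = vabs (1::'a) * 1"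
    using vabs_mult[of "1::'a" 1] by simp
  then show ?thesis
    by (metis mult_cancel_left vabs_eq_0_iff zero_neq_one)
qed

lemma vabs_minus_commute: "vabs (x - y) = vabs (y - x)"
  using dist_commute[of x y] by (simp add: dist_eq_vabs)

lemma vabs_minus [simp]: "vabs (- x) = vabs x"
  using vabs_minus_commute[of 0 x] by simp

lemma vabs_diff_le: "vabs (x - y) \<le> max (vabs x) (vabs y)"
  using vabs_add_le[of x "- y"] by simp

lemma vabs_power: "vabs (x ^ n) = vabs x ^ n"
  by (induction n) (simp_all add: vabs_mult)

lemma vabs_divide: "vabs (x / y) = vabs x / vabs y"
proof (cases "y = 0")
  case False
  then show ?thesis
    using vabs_mult[of "x / y" y] by (simp add: field_simps)
qed simp

lemma vabs_sum_le:
  assumes "\<And>i. i \<in> A \<Longrightarrow> vabs (f i) \<le> c" "c \<ge> 0"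
  shows "vabs (\<Sum>i\<in>A. f i) \<le> c"
  using assms(1)
proof (induction A rule: infinite_finite_induct)
  case (insert a A)
  have "vabs (\<Sum>i\<in>insert a A. f i) \<le> max (vabs (f a)) (vabs (\<Sum>i\<in>A. f i))"
    using insert.hyps vabs_add_le by simp
  also have "\<dots> \<le> c"
    using insert by simp
  finally show ?case .
qed (use assms(2) in simp_all)

lemma vabs_of_nat_le_1: "vabs (of_nat n) \<le> 1"
  using vabs_sum_le[of "{..<n}" "\<lambda>_. 1" 1] by simp

text \<open>This instance and the next one give access to the limit rules for sums, differences,
  products and powers.\<close>

instance complete_nonarch_field \<subseteq> topological_ab_group_add
proof
  fix a b :: 'a
  let ?F = "nhds a \<times>\<^sub>F nhds b"
  have "((\<lambda>z. dist (fst z) a + dist (snd z) b) \<longlongrightarrow> dist a a + dist b b) ?F"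
    by (intro tendsto_intros filterlim_fst filterlim_snd)
  then have "((\<lambda>z. dist (fst z) a + dist (snd z) b) \<longlongrightarrow> 0) ?F"
    by simp
  then have "((\<lambda>z. dist (fst z + snd z) (a + b)) \<longlongrightarrow> 0) ?F"
  proof (rule tendsto_sandwich[OF _ _ tendsto_const, rotated 2])
    show "\<forall>\<^sub>F z in ?F. dist (fst z + snd z) (a + b) \<le> dist (fst z) a + dist (snd z) b"
    proof (rule always_eventually, rule allI)
      fix z :: "'a \<times> 'a"
      have "vabs ((fst z - a) + (snd z - b)) \<le> vabs (fst z - a) + vabs (snd z - b)"
        using vabs_add_le[of "fst z - a" "snd z - b"] vabs_nonneg[of "fst z - a"]
          vabs_nonneg[of "snd z - b"] by linarith
      then show "dist (fst z + snd z) (a + b) \<le> dist (fst z) a + dist (snd z) b"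
        by (simp add: dist_eq_vabs algebra_simps)
    qed
  qed auto
  then show "LIM z ?F. fst z + snd z :> nhds (a + b)"
    by (subst tendsto_dist_iff)
next
  fix a :: 'a
  have "((\<lambda>x. dist x a) \<longlongrightarrow> dist a a) (nhds a)"
    by (intro tendsto_intros filterlim_ident)
  moreover have "dist (- x) (- a) = dist x a" for x
    using vabs_minus_commute[of a x] by (simp add: dist_eq_vabs)
  ultimately show "(uminus \<longlongrightarrow> - a) (nhds a)"
    by (subst tendsto_dist_iff) simp
qed

instance complete_nonarch_field \<subseteq> topological_comm_monoid_mult
proof
  fix a b :: 'a
  let ?F = "nhds a \<times>\<^sub>F nhds b"
  \<comment> \<open>The bound comes from
    \<open>(a + x) (b + y) - a b = x y + x b + a y\<close>.\<close>
  let ?h = "\<lambda>z. dist (fst z) a * dist (snd z) b + dist (fst z) a * vabs b + vabs a * dist (snd z) b"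
  have "(?h \<longlongrightarrow> dist a a * dist b b + dist a a * vabs b + vabs a * dist b b) ?F"
    by (intro tendsto_intros filterlim_fst filterlim_snd)
  then have "(?h \<longlongrightarrow> 0) ?F"
    by simp
  then have "((\<lambda>z. dist (fst z * snd z) (a * b)) \<longlongrightarrow> 0) ?F"
  proof (rule tendsto_sandwich[OF _ _ tendsto_const, rotated 2])
    show "\<forall>\<^sub>F z in ?F. dist (fst z * snd z) (a * b) \<le> ?h z"
    proof (rule always_eventually, rule allI)
      fix z :: "'a \<times> 'a"
      define x y where "x = fst z - a" and "y = snd z - b"
      have tri: "vabs (u + v) \<le> vabs u + vabs v" for u v :: 'a
        using vabs_add_le[of u v] vabs_nonneg[of u] vabs_nonneg[of v] by linarith
      have "vabs (x * y + x * b + a * y) \<le> vabs (x * y) + vabs (x * b) + vabs (a * y)"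
        using tri[of "x * y + x * b" "a * y"] tri[of "x * y" "x * b"] by linarith
      moreover have "x * y + x * b + a * y = fst z * snd z - a * b"
        by (simp add: x_def y_def algebra_simps)
      ultimately show "dist (fst z * snd z) (a * b) \<le> ?h z"
        by (simp add: dist_eq_vabs vabs_mult flip: x_def y_def)
    qed
  qed auto
  then show "LIM z ?F. fst z * snd z :> nhds (a * b)"
    by (subst tendsto_dist_iff)
qed

lemma tendsto_vabs_iff: "(f \<longlongrightarrow> l) F \<longleftrightarrow> ((\<lambda>x. vabs (f x - l)) \<longlongrightarrow> 0) F"
  unfolding tendsto_dist_iff[of f] dist_eq_vabs ..

section \<open>Powers of \<open>q\<close> for exponents that are close p-adically\<close>

lemma vabs_le_1_of_vabs_1_diff_less_1: "vabs (1 - u) < 1 \<Longrightarrow> vabs u \<le> 1"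
  using vabs_diff_le[of 1 "1 - u"] by simp

lemma vabs_eq_1_of_vabs_1_diff_less_1: "vabs (1 - u) < 1 \<Longrightarrow> vabs u = 1"
  using vabs_add_le[of u "1 - u"] vabs_le_1_of_vabs_1_diff_less_1[of u] by auto

lemma vabs_1_diff_power_le:
  assumes "vabs u \<le> 1"
  shows "vabs (1 - u ^ n) \<le> vabs (1 - u)"
proof -
  have "vabs (\<Sum>i<n. u ^ i) \<le> 1"
    by (intro vabs_sum_le) (simp_all add: vabs_power power_le_one assms)
  then show ?thesis
    by (simp add: one_diff_power_eq vabs_mult mult_left_le)
qed

text \<open>The cofactor of \<open>1 - u\<close> in \<open>1 - u ^ p\<close> is a geometric sum of
  \<open>p\<close> terms, each within \<open>vabs (1 - u)\<close> of \<open>1\<close>; it therefore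
  differs from \<open>p\<close> by at most that much.\<close>

lemma vabs_1_diff_power_le_max:
  fixes u :: "'a::complete_nonarch_field"
  assumes "vabs (1 - u) < 1"
  shows "vabs (1 - u ^ p) \<le> max (vabs (of_nat p :: 'a)) (vabs (1 - u)) * vabs (1 - u)"
proof -
  let ?c = "max (vabs (of_nat p :: 'a)) (vabs (1 - u))"
  have "vabs (\<Sum>i<p. 1 - u ^ i) \<le> vabs (1 - u)"
    using assms by (intro vabs_sum_le vabs_1_diff_power_le vabs_le_1_of_vabs_1_diff_less_1) auto
  moreover have "(\<Sum>i<p. u ^ i) = of_nat p - (\<Sum>i<p. 1 - u ^ i)"
    by (simp add: sum_subtractf)
  ultimately have "vabs (\<Sum>i<p. u ^ i) \<le> ?c"
    using vabs_diff_le[of "of_nat p" "\<Sum>i<p. 1 - u ^ i"] by auto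
  then have "vabs (1 - u) * vabs (\<Sum>i<p. u ^ i) \<le> vabs (1 - u) * ?c"
    by (intro mult_left_mono) auto
  then show ?thesis
    by (simp add: one_diff_power_eq vabs_mult mult.commute)
qed

text \<open>Each further \<open>p\<close>-th power contracts the distance to \<open>1\<close> by the
  fixed factor \<open>c < 1\<close>.\<close>

lemma power_prime_power_tendsto_1:
  fixes q :: "'a::complete_nonarch_field"
  assumes p: "vabs (of_nat p :: 'a) < 1" and q: "vabs (1 - q) < 1"
  shows "(\<lambda>N. q ^ (p ^ N)) \<longlonglongrightarrow> 1"
proof -
  define c where "c = max (vabs (of_nat p :: 'a)) (vabs (1 - q))"
  have c: "0 \<le> c" "c < 1"
    using p q by (auto simp: c_def le_max_iff_disj)
  have bound: "vabs (1 - q ^ (p ^ N)) \<le> c ^ N * vabs (1 - q)" for N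
  proof (induction N)
    case (Suc N)
    let ?u = "q ^ (p ^ N)"
    have le: "vabs (1 - ?u) \<le> vabs (1 - q)"
      by (intro vabs_1_diff_power_le vabs_le_1_of_vabs_1_diff_less_1 q)
    have "vabs (1 - q ^ (p ^ Suc N)) = vabs (1 - ?u ^ p)"
      by (simp add: mult.commute flip: power_mult)
    also have "\<dots> \<le> max (vabs (of_nat p :: 'a)) (vabs (1 - ?u)) * vabs (1 - ?u)"
      using le q by (intro vabs_1_diff_power_le_max) simp
    also have "\<dots> \<le> c * (c ^ N * vabs (1 - q))"
      using le Suc c by (intro mult_mono) (auto simp: c_def)
    finally show ?case by (simp add: mult.assoc)
  qed simp
  have "(\<lambda>N. c ^ N * vabs (1 - q)) \<longlonglongrightarrow> 0 * vabs (1 - q)"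
    using c by (intro tendsto_intros LIMSEQ_power_zero) simp
  then have "(\<lambda>N. c ^ N * vabs (1 - q)) \<longlonglongrightarrow> 0"
    by simp
  then have "(\<lambda>N. vabs (1 - q ^ (p ^ N))) \<longlonglongrightarrow> 0"
    by (rule tendsto_sandwich[OF _ _ tendsto_const, rotated 2]) (simp_all add: bound)
  then show ?thesis
    by (subst tendsto_vabs_iff) (simp add: vabs_minus_commute[of _ 1])
qed

lemma of_nat_prime_power_tendsto_0:
  assumes "vabs (of_nat p :: 'a::complete_nonarch_field) < 1"
  shows "(\<lambda>N. of_nat (p ^ N) :: 'a) \<longlonglongrightarrow> 0"
  by (subst tendsto_vabs_iff) (simp add: vabs_power LIMSEQ_power_zero assms)

text \<open>By Bezout the gcd of \<open>d\<close> and \<open>p ^ N\<close>, some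
  \<open>p ^ j\<close> with \<open>j \<le> N\<close>, is a combination of two numbers of absolute
  value at most \<open>1 / p ^ N\<close>. The ultrametric inequality then forces
  \<open>j = N\<close>.\<close>

lemma prime_power_dvd_of_vabs_le:
  fixes p d N :: nat
  assumes p: "prime p" and vp: "vabs (of_nat p :: 'a::complete_nonarch_field) = 1 / real p"
    and d: "vabs (of_nat d :: 'a) \<le> 1 / real p ^ N"
  shows "p ^ N dvd d"
proof (cases "d = 0")
  case False
  have p1: "real p > 1"
    using p prime_gt_1_nat by simp
  obtain x y where xy: "d * x = p ^ N * y + gcd d (p ^ N)"
    using bezout_nat[OF False] by blast
  obtain j where j: "j \<le> N" "gcd d (p ^ N) = p ^ j"
    using divides_primepow_nat[OF p, of "gcd d (p ^ N)" N] by auto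
  have le: "vabs (of_nat (m * x) :: 'a) \<le> vabs (of_nat m :: 'a)" for m x :: nat
    using vabs_of_nat_le_1[of x, where 'a = 'a] by (simp add: vabs_mult mult_left_le)
  have vpow: "vabs (of_nat (p ^ i) :: 'a) = 1 / real p ^ i" for i
    by (simp add: vabs_power vp power_one_over)
  have "(of_nat (d * x) :: 'a) = of_nat (p ^ N * y) + of_nat (p ^ j)"
    unfolding xy j(2) by (rule of_nat_add)
  then have "(of_nat (p ^ j) :: 'a) = of_nat (d * x) - of_nat (p ^ N * y)"
    by (simp only: add_diff_cancel_left')
  then have "vabs (of_nat (p ^ j) :: 'a) \<le> max (vabs (of_nat (d * x) :: 'a)) (vabs (of_nat (p ^ N * y) :: 'a))"
    using vabs_diff_le by metis
  also have "\<dots> \<le> 1 / real p ^ N"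
    using le[of d x] le[of "p ^ N" y] d vpow[of N] by simp
  finally have "real p ^ N \<le> real p ^ j"
    using p1 unfolding vpow by (simp add: field_simps)
  then have "N = j"
    using j(1) p1 by simp
  then show ?thesis
    using j(2) by (metis gcd_dvd1)
qed simp

text \<open>Close exponents differ by a multiple of \<open>p ^ N\<close>, so up to the unit
  \<open>q ^ m\<close> the difference is \<open>1\<close> minus a power of
  \<open>q ^ (p ^ N)\<close>.\<close>

lemma vabs_power_diff_le:
  fixes q :: "'a::complete_nonarch_field"
  assumes p: "prime p" and vp: "vabs (of_nat p :: 'a) = 1 / real p"
    and q: "vabs (1 - q) < 1"
    and mn: "vabs (of_nat m - of_nat n :: 'a) \<le> 1 / real p ^ N"
  shows "vabs (q ^ m - q ^ n) \<le> vabs (1 - q ^ (p ^ N))"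
  using mn
proof (induction m n rule: linorder_wlog)
  case (le m n)
  have q1: "vabs q = 1"
    using q by (rule vabs_eq_1_of_vabs_1_diff_less_1)
  have "vabs (of_nat (n - m) :: 'a) \<le> 1 / real p ^ N"
    using le by (simp add: of_nat_diff vabs_minus_commute)
  then obtain t where t: "n - m = p ^ N * t"
    using prime_power_dvd_of_vabs_le[OF p vp] by blast
  have "q ^ m - q ^ n = q ^ m * (1 - q ^ (n - m))"
    using le by (simp add: right_diff_distrib flip: power_add)
  then have "vabs (q ^ m - q ^ n) = vabs (1 - (q ^ (p ^ N)) ^ t)"
    by (simp add: vabs_mult vabs_power q1 t power_mult)
  also have "\<dots> \<le> vabs (1 - q ^ (p ^ N))"
    by (rule vabs_1_diff_power_le) (simp add: vabs_power q1)
  finally show ?case .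
qed (simp add: vabs_minus_commute)

section \<open>Values of \<open>padic_power\<close> and \<open>qnum\<close> at integers\<close>

lemma padic_power_of_nat_diff:
  fixes q :: "'a::complete_nonarch_field"
  assumes p: "prime p" and vp: "vabs (of_nat p :: 'a) = 1 / real p"
    and q: "vabs (1 - q) < 1"
  shows "padic_power q (of_nat a - of_nat b) = q ^ a / q ^ b"
proof -
  define y :: 'a where "y = of_nat a - of_nat b"
  have p1: "real p > 1"
    using p prime_gt_1_nat by simp
  then have vp1: "vabs (of_nat p :: 'a) < 1"
    by (simp add: vp)
  have q1: "vabs q = 1"
    using q by (rule vabs_eq_1_of_vabs_1_diff_less_1)
  then have q0: "q \<noteq> 0" by auto
  \<comment> \<open>\<open>Lim\<close> is determined only along a nontrivial filter: naturals must
    accumulate at \<open>y\<close> even when \<open>a < b\<close>. The numbers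
    \<open>a + b (p ^ N - 1) = y + b p ^ N\<close> do.\<close>
  have "filtercomap (of_nat :: nat \<Rightarrow> 'a) (nhds y) \<noteq> bot"
  proof (rule filtercomap_neq_bot)
    fix P :: "'a \<Rightarrow> bool"
    assume P: "eventually P (nhds y)"
    have "(\<lambda>N. y + of_nat b * of_nat (p ^ N)) \<longlonglongrightarrow> y + of_nat b * 0"
      by (intro tendsto_intros of_nat_prime_power_tendsto_0 vp1)
    moreover have "y + of_nat b * of_nat (p ^ N) = of_nat (a + b * (p ^ N - 1))" for N
    proof -
      have "(of_nat (p ^ N - 1) :: 'a) = of_nat (p ^ N) - 1"
        using p1 by (subst of_nat_diff) auto
      then show ?thesis
        unfolding y_def of_nat_add of_nat_mult by (simp only: right_diff_distrib) simp
    qed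
    ultimately have "(\<lambda>N. of_nat (a + b * (p ^ N - 1))) \<longlonglongrightarrow> y"
      by (simp only: mult_zero_right add_0_right)
    from filterlim_iff[THEN iffD1, OF this, rule_format, OF P]
    show "\<exists>n. P (of_nat n)"
      using eventually_happens'[OF sequentially_bot] by blast
  qed
  moreover have "((\<lambda>n::nat. q ^ n) \<longlongrightarrow> q ^ a / q ^ b) (filtercomap of_nat (nhds y))"
  proof (rule tendstoI)
    fix e :: real
    assume e: "e > 0"
    have "\<forall>\<^sub>F N in sequentially. dist (q ^ (p ^ N)) 1 < e"
      using power_prime_power_tendsto_1[OF vp1 q] e by (rule tendstoD)
    then obtain N where N: "vabs (1 - q ^ (p ^ N)) < e"
      by (auto simp: eventually_sequentially dist_eq_vabs vabs_minus_commute)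
    \<comment> \<open>Multiplication by \<open>q ^ b\<close>, of absolute value 1, clears the
      possibly negative exponent.\<close>
    have close: "dist (q ^ n) (q ^ a / q ^ b) < e" if "dist (of_nat n) y < 1 / real p ^ N" for n
    proof -
      have "vabs (of_nat (n + b) - of_nat a :: 'a) \<le> 1 / real p ^ N"
        using that by (simp add: dist_eq_vabs y_def algebra_simps)
      then have "vabs (q ^ (n + b) - q ^ a) < e"
        using vabs_power_diff_le[OF p vp q] N by fastforce
      moreover have "q ^ n - q ^ a / q ^ b = (q ^ (n + b) - q ^ a) / q ^ b"
        using q0 by (simp add: field_simps power_add)
      ultimately show ?thesis
        by (simp add: dist_eq_vabs vabs_divide vabs_power q1)
    qed
    have "\<forall>\<^sub>F z in nhds y. dist z y < 1 / real p ^ N"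
      using p1 by (intro eventually_nhds_metric[THEN iffD2] exI[of _ "1 / real p ^ N"]) auto
    then show "\<forall>\<^sub>F n in filtercomap of_nat (nhds y). dist (q ^ n) (q ^ a / q ^ b) < e"
      unfolding eventually_filtercomap using close by blast
  qed
  ultimately show ?thesis
    unfolding padic_power_def y_def by (rule tendsto_Lim)
qed

lemma qnum_of_nat:
  fixes q :: "'a::complete_nonarch_field"
  assumes "prime p" "vabs (of_nat p :: 'a) = 1 / real p" "vabs (1 - q) < 1"
  shows "qnum q (of_nat x) = (\<Sum>i<x. q ^ i)"
  using padic_power_of_nat_diff[OF assms, of x 0]
  by (auto simp: qnum_def one_diff_power_eq)

text \<open>Here \<open>(1 / q)\<close> to the power \<open>1 - x\<close> is
  \<open>q ^ x / q\<close>, and the rest is a field identity in \<open>u = q ^ x\<close>. For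
  \<open>q = 1\<close> both sides are \<open>1 - x\<close>.\<close>

lemma qnum_inverse_reflect:
  fixes q :: "'a::complete_nonarch_field"
  assumes "prime p" "vabs (of_nat p :: 'a) = 1 / real p" and q: "vabs (1 - q) < 1"
  shows "qnum (1 / q) (1 - of_nat x) = 1 - qnum q (of_nat x)"
proof -
  have q1: "vabs q = 1"
    using q by (rule vabs_eq_1_of_vabs_1_diff_less_1)
  then have q0: "q \<noteq> 0" by auto
  have "1 - 1 / q = (q - 1) / q"
    using q0 by (simp add: field_simps)
  then have "vabs (1 - 1 / q) < 1"
    using q by (simp add: vabs_divide q1 vabs_minus_commute)
  from padic_power_of_nat_diff[OF assms(1,2) this, of 1 x]
  have pow: "padic_power (1 / q) (1 - of_nat x) = q ^ x / q"
    by (simp add: power_one_over)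
  show ?thesis
  proof (cases "q = 1")
    case False
    have *: "(1 - u / q) / (1 - 1 / q) = 1 - (1 - u) / (1 - q)" for u
      using q0 False by (simp add: field_simps)
    then show ?thesis
      using False padic_power_of_nat_diff[OF assms, of x 0] by (simp add: qnum_def pow *[of "q ^ x"])
  qed (simp add: qnum_def)
qed

section \<open>Limits of the Riemann sums\<close>

lemma tendsto_mult_left_cancelD:
  fixes c l :: "'a::complete_nonarch_field"
  assumes "c \<noteq> 0" and "((\<lambda>x. c * f x) \<longlongrightarrow> c * l) F"
  shows "(f \<longlongrightarrow> l) F"
  using tendsto_mult[OF tendsto_const[of "1 / c"] assms(2)] assms(1) by simp

text \<open>The binomial sum builds \<open>(q y + 1) ^ k\<close>, the \<open>k\<close>-th power of
  the next q-number, so the difference telescopes. The boundary term \<open>0 ^ k\<close> comes from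
  \<open>x = 0\<close> and is \<open>1\<close> for \<open>k = 0\<close>.\<close>

lemma q_geometric_power_sum_shift:
  fixes q :: "'a::comm_ring_1"
  shows "q * (\<Sum>i\<le>k. of_nat (k choose i) * q ^ i * (\<Sum>x<M. (\<Sum>j<x. q ^ j) ^ i * q ^ x))
           - (\<Sum>x<M. (\<Sum>j<x. q ^ j) ^ k * q ^ x)
         = (\<Sum>j<M. q ^ j) ^ k * q ^ M - 0 ^ k"
proof -
  define y where "y x = (\<Sum>j<x. q ^ j)" for x
  have y_Suc: "y (Suc x) = q * y x + 1" for x
    unfolding y_def by (subst sum.lessThan_Suc_shift) (simp add: sum_distrib_left)
  have "(\<Sum>i\<le>k. of_nat (k choose i) * q ^ i * (\<Sum>x<M. y x ^ i * q ^ x))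
      = (\<Sum>x<M. (\<Sum>i\<le>k. of_nat (k choose i) * q ^ i * (y x ^ i * q ^ x)))"
    unfolding sum_distrib_left by (rule sum.swap)
  also have "\<dots> = (\<Sum>x<M. y (Suc x) ^ k * q ^ x)"
    by (simp add: y_Suc binomial_ring sum_distrib_right power_mult_distrib mult.assoc)
  finally have "q * (\<Sum>i\<le>k. of_nat (k choose i) * q ^ i * (\<Sum>x<M. y x ^ i * q ^ x))
      - (\<Sum>x<M. y x ^ k * q ^ x) = (\<Sum>x<M. y (Suc x) ^ k * q ^ Suc x - y x ^ k * q ^ x)"
    by (simp add: sum_distrib_left sum_subtractf mult.left_commute)
  also have "\<dots> = y M ^ k * q ^ M - 0 ^ k"
    by (subst sum_lessThan_telescope) (simp add: y_def)
  finally show ?thesis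
    by (simp add: y_def)
qed

text \<open>A sequence obeying the Carlitz recurrence up to a vanishing error converges to its
  solution, by induction along the equation that determines the \<open>k\<close>-th term.\<close>

lemma tendsto_carlitz_of_recurrence:
  fixes q :: "'a::complete_nonarch_field"
  assumes roots: "\<And>m. m > 0 \<Longrightarrow> q ^ m = 1 \<Longrightarrow> q = 1"
    and \<beta>: "carlitz_sequence q \<beta>"
    and T0: "\<And>N. T 0 N = 1"
    and rec: "\<And>k N. q * (\<Sum>i\<le>Suc k. of_nat (Suc k choose i) * q ^ i * T i N) - T (Suc k) N = r k N"
    and r: "\<And>k. r k \<longlonglongrightarrow> (if k = 0 then 1 else 0)"
  shows "T k \<longlonglongrightarrow> \<beta> k"
proof (induction k rule: less_induct)
  case (less k)
  have \<beta>rec: "q * (\<Sum>i\<le>Suc k. of_nat (Suc k choose i) * q ^ i * \<beta> i) - \<beta> (Suc k)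
      = (if k = 0 then 1 else 0)" for k
    using \<beta>[unfolded carlitz_sequence_def, THEN conjunct2, rule_format, of "Suc k"] by simp
  have lower: "(\<lambda>N. \<Sum>i<k. c i * T i N) \<longlonglongrightarrow> (\<Sum>i<k. c i * \<beta> i)" for c
    by (intro tendsto_sum tendsto_mult tendsto_const less.IH) simp
  show ?case
  proof (cases "q = 1")
    \<comment> \<open>For \<open>q = 1\<close> the equation of index \<open>Suc k\<close> is used:
      \<open>T (Suc k)\<close> cancels and \<open>T k\<close> keeps the coefficient
      \<open>Suc k\<close>.\<close>
    case True
    let ?c = "\<lambda>i. of_nat (Suc k choose i) :: 'a"
    have "of_nat (Suc k) * T k N = r k N - (\<Sum>i<k. ?c i * T i N)" for N
      using rec[of k N] by (simp add: True algebra_simps flip: lessThan_Suc_atMost)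
    moreover have "of_nat (Suc k) * \<beta> k = (if k = 0 then 1 else 0) - (\<Sum>i<k. ?c i * \<beta> i)"
      using \<beta>rec[of k] by (simp add: True algebra_simps flip: lessThan_Suc_atMost)
    ultimately have "(\<lambda>N. of_nat (Suc k) * T k N) \<longlonglongrightarrow> of_nat (Suc k) * \<beta> k"
      using tendsto_diff[OF r lower, of k ?c] by simp
    then show ?thesis
      by (rule tendsto_mult_left_cancelD[rotated]) (simp only: of_nat_eq_0_iff)
  next
    case False
    show ?thesis
    proof (cases k)
      case 0
      then show ?thesis
        using \<beta> T0 by (simp add: carlitz_sequence_def)
    next
      case (Suc m)
      \<comment> \<open>For \<open>q \<noteq> 1\<close> the equation of index \<open>k\<close>
        itself determines \<open>T k\<close>, with coefficient \<open>q ^ Suc k - 1\<close>.\<close>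
      let ?c = "\<lambda>i. q * of_nat (k choose i) * q ^ i"
      have "(q ^ Suc k - 1) * T k N = r m N - (\<Sum>i<k. ?c i * T i N)" for N
        using rec[of m N]
        by (simp add: algebra_simps sum_distrib_left flip: lessThan_Suc_atMost Suc)
      moreover have "(q ^ Suc k - 1) * \<beta> k = (if m = 0 then 1 else 0) - (\<Sum>i<k. ?c i * \<beta> i)"
        using \<beta>rec[of m]
        by (simp add: algebra_simps sum_distrib_left flip: lessThan_Suc_atMost Suc)
      ultimately have "(\<lambda>N. (q ^ Suc k - 1) * T k N) \<longlonglongrightarrow> (q ^ Suc k - 1) * \<beta> k"
        using tendsto_diff[OF r lower, of m ?c] by simp
      moreover have "q ^ Suc k - 1 \<noteq> 0"
        using roots[of "Suc k"] False by auto
      ultimately show ?thesis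
        by (rule tendsto_mult_left_cancelD[rotated])
    qed
  qed
qed

text \<open>Riemann sums sample \<open>f\<close> only at naturals, so agreement with a polynomial in
  \<open>qnum\<close> there suffices. By linearity the limit reduces to the normalised power sums
  \<open>T k\<close>.\<close>

lemma q_riemann_sum_poly_tendsto:
  fixes q :: "'a::complete_nonarch_field"
  assumes p: "prime p" and vp: "vabs (of_nat p :: 'a) = 1 / real p"
    and q: "vabs (1 - q) < 1"
    and roots: "\<And>m. m > 0 \<Longrightarrow> q ^ m = 1 \<Longrightarrow> q = 1"
    and \<beta>: "carlitz_sequence q \<beta>"
    and f: "\<And>x::nat. f (of_nat x) = poly P (qnum q (of_nat x))"
  shows "q_riemann_sum p q f \<longlonglongrightarrow> umbral \<beta> P"
proof -
  define y where "y x = (\<Sum>j<x. q ^ j)" for x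
  define T where "T k N = 1 / y (p ^ N) * (\<Sum>x<p ^ N. y x ^ k * q ^ x)" for k N
  have p1: "p > 1"
    using p by (rule prime_gt_1_nat)
  then have vp1: "vabs (of_nat p :: 'a) < 1"
    by (simp add: vp)
  have y: "(1 - q) * y x = 1 - q ^ x" for x
    by (simp add: y_def one_diff_power_eq)
  have nz: "y (p ^ N) \<noteq> 0" for N
  proof (cases "q = 1")
    case True
    then show ?thesis using p1 by (simp add: y_def)
  next
    case False
    then have "q ^ (p ^ N) \<noteq> 1"
      using roots[of "p ^ N"] p1 by auto
    then show ?thesis
      using y[of "p ^ N"] by auto
  qed
  have Q: "(\<lambda>N. q ^ (p ^ N)) \<longlonglongrightarrow> 1"
    using vp1 q by (rule power_prime_power_tendsto_1)
  have ylim: "(\<lambda>N. y (p ^ N)) \<longlonglongrightarrow> 0"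
  proof (cases "q = 1")
    case True
    then show ?thesis
      using of_nat_prime_power_tendsto_0[OF vp1] by (simp add: y_def)
  next
    case False
    show ?thesis
    proof (rule tendsto_mult_left_cancelD)
      show "1 - q \<noteq> 0" using False by simp
      show "(\<lambda>N. (1 - q) * y (p ^ N)) \<longlonglongrightarrow> (1 - q) * 0"
        using tendsto_diff[OF tendsto_const[of 1] Q] by (simp add: y)
    qed
  qed
  have T: "T k \<longlonglongrightarrow> \<beta> k" for k
  proof (rule tendsto_carlitz_of_recurrence[OF roots \<beta>])
    show "T 0 N = 1" for N
      using nz[of N] by (simp add: T_def flip: y_def)
    show "q * (\<Sum>i\<le>Suc k. of_nat (Suc k choose i) * q ^ i * T i N) - T (Suc k) N
        = y (p ^ N) ^ k * q ^ (p ^ N)" for k N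
    proof -
      define S where "S i = (\<Sum>x<p ^ N. y x ^ i * q ^ x)" for i
      have TS: "T i N = 1 / y (p ^ N) * S i" for i
        by (simp add: T_def S_def)
      have "q * (\<Sum>i\<le>Suc k. of_nat (Suc k choose i) * q ^ i * T i N) - T (Suc k) N
          = 1 / y (p ^ N) * (q * (\<Sum>i\<le>Suc k. of_nat (Suc k choose i) * q ^ i * S i) - S (Suc k))"
        unfolding TS right_diff_distrib sum_distrib_left by (simp only: mult_ac)
      also have "\<dots> = 1 / y (p ^ N) * (y (p ^ N) ^ Suc k * q ^ (p ^ N))"
        using q_geometric_power_sum_shift[of q "Suc k" "p ^ N"] by (simp only: S_def y_def) simp
      finally show ?thesis
        using nz[of N] by simp
    qed
    \<comment> \<open>Division of the telescoped sum by \<open>y (p ^ N)\<close> leaves one power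
      fewer, so the remainder survives only at \<open>k = 0\<close>.\<close>
    show "(\<lambda>N. y (p ^ N) ^ k * q ^ (p ^ N)) \<longlonglongrightarrow> (if k = 0 then 1 else 0)" for k
      using tendsto_mult[OF tendsto_power_strong[OF ylim tendsto_const[of k]] Q]
      by (simp add: power_0_left)
  qed
  have "q_riemann_sum p q f N = (\<Sum>i\<le>degree P. coeff P i * T i N)" for N
  proof -
    have "{0..M - 1} = {..<M}" if "M > 0" for M :: nat
      using that by auto
    from this[of "p ^ N"] have "{0..p ^ N - 1} = {..<p ^ N}"
      using p1 by simp
    then have "q_riemann_sum p q f N = 1 / y (p ^ N) * (\<Sum>x<p ^ N. poly P (y x) * q ^ x)"
      by (simp only: q_riemann_sum_def f qnum_of_nat[OF p vp q] y_def)
    also have "(\<Sum>x<p ^ N. poly P (y x) * q ^ x)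
        = (\<Sum>x<p ^ N. \<Sum>i\<le>degree P. coeff P i * (y x ^ i * q ^ x))"
      by (simp add: poly_altdef sum_distrib_right mult.assoc)
    also have "\<dots> = (\<Sum>i\<le>degree P. \<Sum>x<p ^ N. coeff P i * (y x ^ i * q ^ x))"
      by (rule sum.swap)
    finally show ?thesis
      by (simp add: T_def sum_distrib_left mult.left_commute)
  qed
  then have "q_riemann_sum p q f = (\<lambda>N. \<Sum>i\<le>degree P. coeff P i * T i N)"
    by (rule ext)
  moreover have "(\<lambda>N. \<Sum>i\<le>degree P. coeff P i * T i N) \<longlonglongrightarrow> umbral \<beta> P"
    unfolding umbral_def by (intro tendsto_sum tendsto_mult tendsto_const T)
  ultimately show ?thesis
    by simp
qed

lemma q_integral_poly:
  fixes q :: "'a::complete_nonarch_field"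
  assumes "prime p" "vabs (of_nat p :: 'a) = 1 / real p" "vabs (1 - q) < 1"
    and "\<And>m. m > 0 \<Longrightarrow> q ^ m = 1 \<Longrightarrow> q = 1"
    and "carlitz_sequence q \<beta>"
    and "\<And>x::nat. f (of_nat x) = poly P (qnum q (of_nat x))"
  shows "q_integrable p q f" "q_integral p q f = umbral \<beta> P"
proof -
  have "q_riemann_sum p q f \<longlonglongrightarrow> umbral \<beta> P"
    by (rule q_riemann_sum_poly_tendsto) fact+
  then show "q_integrable p q f" "q_integral p q f = umbral \<beta> P"
    by (auto simp: q_integrable_def q_integral_def convergent_def limI)
qed

section \<open>Products of Bernstein polynomials and the two integral formulas\<close>

lemma carlitz_sequence_carlitz_bernoulli:
  fixes q :: "'a::field_char_0"
  assumes "\<And>m. m > 0 \<Longrightarrow> q ^ m = 1 \<Longrightarrow> q = 1"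
  shows "carlitz_sequence q (\<lambda>k. carlitz_bernoulli k q)"
  unfolding carlitz_bernoulli_def by (rule theI'[OF carlitz_sequence_ex1[OF assms]])

text \<open>The variable stands for \<open>[x]_q\<close>, and \<open>1 - X\<close> for the q-number
  of \<open>1 - x\<close> with base \<open>1 / q\<close>.\<close>

definition bernstein_poly :: "nat \<Rightarrow> (nat \<Rightarrow> nat) \<Rightarrow> nat \<Rightarrow> 'a::comm_ring_1 poly" where
  "bernstein_poly s n k = smult (\<Prod>i=1..s. of_nat (n i choose k))
     ([:1, - 1:] ^ ((\<Sum>i=1..s. n i) - s * k) * [:0, 1:] ^ (s * k))"

lemma prod_q_bernstein_of_nat:
  fixes q :: "'a::complete_nonarch_field"
  assumes "prime p" "vabs (of_nat p :: 'a) = 1 / real p" "vabs (1 - q) < 1"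
  shows "(\<Prod>i=1..s. q_bernstein k (n i) (of_nat x) q)
           = poly (bernstein_poly s n k) (qnum q (of_nat x))"
proof (cases "\<exists>i\<in>{1..s}. n i < k")
  \<comment> \<open>If some \<open>n i < k\<close>, the truncated exponents need not add up to
    \<open>(\<Sum>i=1..s. n i) - s * k\<close>, but a zero binomial coefficient kills both
    sides.\<close>
  case True
  then have "(\<Prod>i=1..s. of_nat (n i choose k)) = (0::'a)"
    by (intro prod_zero) (auto simp: binomial_eq_0)
  then show ?thesis
    by (simp add: q_bernstein_def bernstein_poly_def prod.distrib)
next
  case False
  then have "(\<Sum>i=1..s. n i - k) = (\<Sum>i=1..s. n i) - s * k"
    by (subst sum_subtractf_nat) (auto simp: not_less)
  then show ?thesis
    by (simp add: q_bernstein_def bernstein_poly_def prod.distrib qnum_inverse_reflect[OF assms]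
        poly_power power_mult power_sum[symmetric] mult.commute[of s] mult_ac)
qed

theorem theorem4:
  fixes p :: nat and q :: "'a::complete_nonarch_field"
  assumes "prime p"
    and "is_Cp p TYPE('a)"
    and "vabs (1 - q) < 1"
    and "\<And>m. m > 0 \<Longrightarrow> q ^ m = 1 \<Longrightarrow> q = 1"
  shows
    "(\<forall>(s::nat) (n :: nat \<Rightarrow> nat) (k::nat).
       s \<ge> 1 \<and> (\<forall>i\<in>{1..s}. n i \<ge> 1) \<and> k \<ge> 1 \<and> (\<Sum>i=1..s. n i) > s * k + 1 \<longrightarrow>
       q_integrable p q (\<lambda>x. \<Prod>i=1..s. q_bernstein k (n i) x q) \<and>
       q_integral p q (\<lambda>x. \<Prod>i=1..s. q_bernstein k (n i) x q) =
         (\<Prod>i=1..s. of_nat (n i choose k)) *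
         (\<Sum>l=0..s * k. of_nat (s * k choose l) * (- 1) ^ (s * k + l) *
            (of_nat (\<Sum>i=1..s. n i) - of_nat l + 1 - q
             + q ^ 2 * carlitz_bernoulli ((\<Sum>i=1..s. n i) - l) (1 / q)))) \<and>
     (\<forall>(s::nat) (n :: nat \<Rightarrow> nat) (k::nat).
       s \<ge> 1 \<longrightarrow>
       q_integrable p q (\<lambda>x. \<Prod>i=1..s. q_bernstein k (n i) x q) \<and>
       q_integral p q (\<lambda>x. \<Prod>i=1..s. q_bernstein k (n i) x q) =
         (\<Prod>i=1..s. of_nat (n i choose k)) *
         (\<Sum>l=0..(\<Sum>i=1..s. n i) - s * k.
            of_nat ((\<Sum>i=1..s. n i) - s * k choose l) * (- 1) ^ l *
            carlitz_bernoulli (s * k + l) q))"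
proof -
  have vp: "vabs (of_nat p :: 'a) = 1 / real p"
    using assms(2) by (simp add: is_Cp_def)
  have "vabs q = 1"
    using assms(3) by (rule vabs_eq_1_of_vabs_1_diff_less_1)
  then have q0: "q \<noteq> 0" by auto
  have roots': "1 / q = 1" if "m > 0" "(1 / q) ^ m = 1" for m
    using assms(4)[of m] that q0 by (simp add: power_one_over)
  define \<beta> where "\<beta> k = carlitz_bernoulli k q" for k
  define \<beta>' where "\<beta>' k = carlitz_bernoulli k (1 / q)" for k
  have \<beta>: "carlitz_sequence q \<beta>"
    unfolding \<beta>_def using assms(4) by (rule carlitz_sequence_carlitz_bernoulli)
  have \<beta>': "carlitz_sequence (1 / q) \<beta>'"
    unfolding \<beta>'_def using roots' by (rule carlitz_sequence_carlitz_bernoulli)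
  have uniq: "\<exists>!\<beta>. carlitz_sequence q \<beta>"
    using assms(4) by (rule carlitz_sequence_ex1)
  have integral:
      "q_integrable p q (\<lambda>x. \<Prod>i=1..s. q_bernstein k (n i) x q)"
      "q_integral p q (\<lambda>x. \<Prod>i=1..s. q_bernstein k (n i) x q) = umbral \<beta> (bernstein_poly s n k)"
    for s n k
    by (rule q_integral_poly[OF assms(1) vp assms(3) _ \<beta> prod_q_bernstein_of_nat[OF assms(1) vp assms(3)]],
        rule assms(4), assumption+)+
  have second: "umbral \<beta> (bernstein_poly s n k) = (\<Prod>i=1..s. of_nat (n i choose k)) *
         (\<Sum>l=0..(\<Sum>i=1..s. n i) - s * k.
            of_nat ((\<Sum>i=1..s. n i) - s * k choose l) * (- 1) ^ l * \<beta> (s * k + l))" for s n k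
    by (simp add: bernstein_poly_def umbral_smult umbral_linear_power_mult atLeast0AtMost add.commute)
  have first: "umbral \<beta> (bernstein_poly s n k) = (\<Prod>i=1..s. of_nat (n i choose k)) *
         (\<Sum>l=0..s * k. of_nat (s * k choose l) * (- 1) ^ (s * k + l) *
            (of_nat (\<Sum>i=1..s. n i) - of_nat l + 1 - q + q ^ 2 * \<beta>' ((\<Sum>i=1..s. n i) - l)))"
    if large: "(\<Sum>i=1..s. n i) > s * k + 1" for s n k
  proof -
    define K where "K = s * k"
    define m where "m = (\<Sum>i=1..s. n i) - K"
    let ?h = "reflected_carlitz q \<beta>'"
    \<comment> \<open>\<open>m > 1\<close> keeps every index \<open>l + m\<close> above
      \<open>1\<close>, away from the corrections in \<open>reflected_carlitz\<close>. This is where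
      the size condition of (I) enters.\<close>
    have m: "m > 1" "(\<Sum>i=1..s. n i) = K + m"
      using large by (auto simp: m_def K_def)
    \<comment> \<open>The reflection exchanges \<open>X\<close> and \<open>1 - X\<close>, leaving
      only the \<open>K\<close>-th power to expand.\<close>
    have "umbral \<beta> ([:1, - 1:] ^ m * [:0, 1:] ^ K) = umbral ?h ([:1, - 1:] ^ K * [:0, 1:] ^ m)"
      unfolding umbral_reflect[OF q0 uniq \<beta> \<beta>']
      by (simp add: pcompose_mult pcompose_power pcompose_pCons mult.commute)
    also have "\<dots> = (\<Sum>l\<le>K. of_nat (K choose l) * (- 1) ^ l * ?h (l + m))"
      by (simp add: umbral_linear_power_mult)
    also have "\<dots> = (\<Sum>l\<le>K. of_nat (K choose (K - l)) * (- 1) ^ (K - l) * ?h (K - l + m))"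
      by (rule sum.nat_diff_reindex[symmetric, of _ "Suc K", unfolded lessThan_Suc_atMost, simplified])
    also have "\<dots> = (\<Sum>l\<le>K. of_nat (K choose l) * (- 1) ^ (K + l) *
            (of_nat (K + m) - of_nat l + 1 - q + q ^ 2 * \<beta>' (K + m - l)))"
    proof (rule sum.cong[OF refl])
      fix l
      assume "l \<in> {..K}"
      then have l: "l \<le> K" by simp
      \<comment> \<open>\<open>K + l\<close> and \<open>K - l\<close> have the same parity.\<close>
      then have "(- 1 :: 'a) ^ (K + l) = (- 1) ^ (K - l)"
        using minus_one_power_iff[of "K + l", where 'a = 'a]
          minus_one_power_iff[of "K - l", where 'a = 'a] by auto
      moreover have "?h (K - l + m) = of_nat (K + m) - of_nat l + 1 - q + q ^ 2 * \<beta>' (K + m - l)"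
        using l m(1) by (simp add: reflected_carlitz_def of_nat_diff)
      moreover have "K choose (K - l) = K choose l"
        using l by (rule binomial_symmetric[symmetric])
      ultimately show "of_nat (K choose (K - l)) * (- 1) ^ (K - l) * ?h (K - l + m)
          = of_nat (K choose l) * (- 1) ^ (K + l) *
            (of_nat (K + m) - of_nat l + 1 - q + q ^ 2 * \<beta>' (K + m - l))"
        by simp
    qed
    finally show ?thesis
      unfolding bernstein_poly_def umbral_smult atLeast0AtMost K_def[symmetric] m(2)
      by (simp only: add_diff_cancel_left')
  qed
  show ?thesis
    unfolding integral(2) \<beta>_def[symmetric] \<beta>'_def[symmetric]
  proof (intro conjI allI impI, goal_cases)
    case (2 s n k)
    then show ?case by (intro first) blast
  qed (rule integral(1) second)+
qed

end
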